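(* Let $n$ be a positive integer such that there exists a positive integer $m$ for which $\{T_n,T_m\}$ is a $D(-1)$-pair. Then both $n$ and $n+1$ are numbers of the form $2^e\cdot p_1^{\alpha_1}\cdots p_l^{\alpha_l}$ (with $l\ge 0$, the product of prime powers possibly being empty), where the $p_i$ are prime numbers with $p_i\equiv 1\pmod 4$ for each $i\in\{1,\dots,l\}$, $\alpha_1,\dots,\alpha_l$ are positive integers, and $e\in\{0,2\}$ for $n$ and $e\in\{0,1\}$ for $n+1$.
   Context: For a positive integer $n$, $T_n=\frac{n(n+1)}{2}$ denotes the $n$-th triangular number. A $D(-1)$-pair is a set of two distinct positive integers whose product decreased by $1$ is a perfect square. *)

theory Defs
  imports "HOL-Library.Nat_Bijection" "HOL-Number_Theory.Number_Theory"
    "HOL-Computational_Algebra.Nth_Powers"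
begin

(* The n-th triangular number is the library function triangle of HOL-Library.Nat_Bijection. *)

(* The subtraction below is not truncated: a * b \<ge> 1 because both factors are positive. *)
definition D_minus1_pair :: "nat set \<Rightarrow> bool" where
  "D_minus1_pair S \<longleftrightarrow>
     (\<exists>a b. S = {a, b} \<and> a \<noteq> b \<and> a > 0 \<and> b > 0 \<and> is_nth_power 2 (a * b - 1))"

(* l = 0 is allowed and gives the empty product. The primes p 1, ..., p l need not be distinct. *)
definition pow2_times_primes_1_mod_4 :: "nat \<Rightarrow> nat \<Rightarrow> bool" where
  "pow2_times_primes_1_mod_4 e N \<longleftrightarrow>
     (\<exists>(l::nat) (p::nat \<Rightarrow> nat) (\<alpha>::nat \<Rightarrow> nat).
        (\<forall>i\<in>{1..l}. prime (p i) \<and> [p i = 1] (mod 4) \<and> \<alpha> i > 0) \<and>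
        N = 2 ^ e * (\<Prod>i=1..l. p i ^ \<alpha> i))"

end

theory Submission
  imports Defs
begin

text \<open>
  Write \<open>T\<close> for the triangular number of \<open>n\<close>. If \<open>T\<close> belongs to a \<open>D(-1)\<close>-pair, then \<open>T\<close> divides
  some \<open>k\<^sup>2 + 1\<close>. Now \<open>-1\<close> is a square neither modulo \<open>4\<close> nor modulo a prime \<open>p \<equiv> 3 (mod 4)\<close>, so
  \<open>T\<close> is not divisible by \<open>4\<close> and every odd prime factor of \<open>T\<close>, hence of \<open>n\<close> and of \<open>n + 1\<close>
  (because \<open>n (n + 1) = 2 T\<close>), is \<open>1\<close> modulo \<open>4\<close>.

  It remains to determine the power of \<open>2\<close>. Whichever of \<open>n\<close> and \<open>n + 1\<close> is odd is a product of
  primes that are \<open>1\<close> modulo \<open>4\<close>, and so is itself \<open>1\<close> modulo \<open>4\<close>. If this is \<open>n\<close>, then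
  \<open>n + 1 \<equiv> 2 (mod 4)\<close> contains exactly one factor \<open>2\<close>. If it is \<open>n + 1\<close>, then \<open>4\<close> divides \<open>n\<close>,
  while \<open>8\<close> does not, since otherwise \<open>4\<close> would divide \<open>T\<close>; hence \<open>n\<close> contains exactly two
  factors \<open>2\<close>.
\<close>

text \<open>
  If \<open>p = 4 q + 3\<close>, raising \<open>k\<^sup>2 \<equiv> -1\<close> to the odd power \<open>2 q + 1 = (p - 1) / 2\<close> contradicts
  Fermat's little theorem.
\<close>
lemma odd_prime_dvd_square_plus_1:
  fixes p k :: nat
  assumes "prime p" "odd p" "p dvd k\<^sup>2 + 1"
  shows "[p = 1] (mod 4)"
proof (rule ccontr)
  assume "\<not> [p = 1] (mod 4)"
  then have "p mod 4 = 3"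
    using \<open>odd p\<close> unfolding cong_def by presburger
  then obtain q where q: "p = 4 * q + 3"
    by (metis mult_div_mod_eq)
  have "\<not> p dvd k"
  proof
    assume "p dvd k"
    then have "p dvd k\<^sup>2"
      by (simp add: power2_eq_square)
    then have "p dvd 1"
      using assms(3) dvd_add_right_iff by blast
    then show False
      using \<open>prime p\<close> not_prime_unit by blast
  qed
  then have "[k ^ (p - 1) = 1] (mod p)"
    using \<open>prime p\<close> by (rule fermat_theorem[rotated])
  then have fermat: "[int k ^ (p - 1) = 1] (mod int p)"
    by (metis cong_int_iff of_nat_1 of_nat_power)
  have "int p dvd int (k\<^sup>2 + 1)"
    using assms(3) by (simp only: int_dvd_int_iff)
  then have "[(int k)\<^sup>2 = - 1] (mod int p)"
    by (simp add: cong_iff_dvd_diff add.commute)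
  then have "[((int k)\<^sup>2) ^ (2 * q + 1) = (- 1) ^ (2 * q + 1)] (mod int p)"
    by (rule cong_pow)
  moreover have "((int k)\<^sup>2) ^ (2 * q + 1) = int k ^ (p - 1)"
    unfolding power_mult[symmetric] by (simp add: q)
  ultimately have "[int k ^ (p - 1) = - 1] (mod int p)"
    by simp
  with fermat have "[1 = - 1] (mod int p)"
    using cong_sym cong_trans by blast
  then have "int p dvd 2"
    by (simp add: cong_iff_dvd_diff)
  then have "p \<le> 2"
    using zdvd_imp_le by fastforce
  with q show False
    by simp
qed

lemma not_4_dvd_square_plus_1: "\<not> 4 dvd (k::nat)\<^sup>2 + 1"
proof (cases "even k")
  case True
  then have "even (k\<^sup>2)"
    by simp
  then show ?thesis
    by presburger
next
  case False
  then obtain j where "k = 2 * j + 1"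
    by (rule oddE)
  then have "k\<^sup>2 + 1 = 4 * (j\<^sup>2 + j) + 2"
    by (simp add: power2_eq_square algebra_simps)
  then show ?thesis
    by presburger
qed

lemma D_minus1_pair_dvd_square_plus_1:
  assumes "D_minus1_pair {a, b}"
  obtains k where "a dvd k\<^sup>2 + 1"
proof -
  obtain c d where cd: "{a, b} = {c, d}" "c > 0" "d > 0" "is_nth_power 2 (c * d - 1)"
    using assms unfolding D_minus1_pair_def by blast
  from cd(4) obtain k where "c * d - 1 = k\<^sup>2"
    unfolding is_nth_power_def by blast
  moreover have "c * d > 0"
    using cd by simp
  ultimately have "c * d = k\<^sup>2 + 1"
    by linarith
  moreover have "a = c \<or> a = d"
    using cd(1) by blast
  ultimately have "a dvd k\<^sup>2 + 1"
    by (metis dvd_triv_left dvd_triv_right)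
  with that show thesis .
qed

lemma pow2_times_primes_1_mod_4_mult_prime:
  assumes "pow2_times_primes_1_mod_4 e N" "prime q" "[q = 1] (mod 4)"
  shows "pow2_times_primes_1_mod_4 e (q * N)"
proof -
  obtain l :: nat and p \<alpha> :: "nat \<Rightarrow> nat" where
    p: "\<forall>i\<in>{1..l}. prime (p i) \<and> [p i = 1] (mod 4) \<and> \<alpha> i > 0"
    and N: "N = 2 ^ e * (\<Prod>i=1..l. p i ^ \<alpha> i)"
    using assms(1) unfolding pow2_times_primes_1_mod_4_def by blast
  \<comment> \<open>The primes of a representation may repeat, so \<open>q\<close> can always be appended as a new factor.\<close>
  define p' where "p' = p(Suc l := q)"
  define \<alpha>' where "\<alpha>' = \<alpha>(Suc l := 1)"
  have "(\<Prod>i=1..l. p' i ^ \<alpha>' i) = (\<Prod>i=1..l. p i ^ \<alpha> i)"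
    by (rule prod.cong) (auto simp: p'_def \<alpha>'_def)
  then have "q * N = 2 ^ e * (\<Prod>i=1..Suc l. p' i ^ \<alpha>' i)"
    by (simp add: N p'_def \<alpha>'_def)
  moreover have "\<forall>i\<in>{1..Suc l}. prime (p' i) \<and> [p' i = 1] (mod 4) \<and> \<alpha>' i > 0"
    using p assms(2,3) by (auto simp: p'_def \<alpha>'_def le_Suc_eq)
  ultimately show ?thesis
    unfolding pow2_times_primes_1_mod_4_def by blast
qed

text \<open>
  Besides the representation, the induction over the prime factors yields the residue of \<open>N\<close>
  modulo \<open>4\<close>, which is what decides the power of \<open>2\<close> in the neighbours of \<open>N\<close>.
\<close>
lemma odd_with_prime_factors_1_mod_4:
  fixes N :: nat
  assumes "odd N" "\<And>p. prime p \<Longrightarrow> p dvd N \<Longrightarrow> [p = 1] (mod 4)"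
  shows "pow2_times_primes_1_mod_4 e (2 ^ e * N) \<and> [N = 1] (mod 4)"
  using assms
proof (induction N rule: prime_divisors_induct)
  case zero
  then show ?case
    by simp
next
  case (unit N)
  have "pow2_times_primes_1_mod_4 e (2 ^ e)"
    unfolding pow2_times_primes_1_mod_4_def by (rule exI[of _ 0]) auto
  with unit show ?case
    by simp
next
  case (factor p N)
  then have p: "[p = 1] (mod 4)"
    by simp
  have IH: "pow2_times_primes_1_mod_4 e (2 ^ e * N)" "[N = 1] (mod 4)"
    using factor by auto
  have "pow2_times_primes_1_mod_4 e (p * (2 ^ e * N))"
    using IH(1) factor.hyps p by (rule pow2_times_primes_1_mod_4_mult_prime)
  moreover have "[p * N = 1 * 1] (mod 4)"
    using p IH(2) by (rule cong_mult)
  ultimately show ?case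
    by (simp add: mult.left_commute)
qed

theorem corollary10:
  fixes n :: nat
  assumes "n > 0"
    and "\<exists>m::nat. m > 0 \<and> D_minus1_pair {triangle n, triangle m}"
  shows "(\<exists>e\<in>{0, 2}. pow2_times_primes_1_mod_4 e n) \<and>
         (\<exists>e\<in>{0, 1}. pow2_times_primes_1_mod_4 e (n + 1))"
proof -
  obtain k where k: "triangle n dvd k\<^sup>2 + 1"
    using assms(2) D_minus1_pair_dvd_square_plus_1 by metis
  have twice: "n * (n + 1) = 2 * triangle n"
    by (simp add: triangle_def)
  have primes: "[p = 1] (mod 4)" if "prime p" "odd p" "p dvd n * (n + 1)" for p
  proof -
    have "coprime p 2"
      using \<open>odd p\<close> by simp
    then have "p dvd triangle n"
      using that(3) unfolding twice by (simp add: coprime_dvd_mult_right_iff)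
    then show ?thesis
      using odd_prime_dvd_square_plus_1 that(1,2) k dvd_trans by blast
  qed
  have form: "pow2_times_primes_1_mod_4 e (2 ^ e * N)" "[N = 1] (mod 4)"
    if "odd N" "N dvd n * (n + 1)" for N e
    using odd_with_prime_factors_1_mod_4[of N e] primes that
    by (meson dvd_trans)+
  show ?thesis
  proof (cases "even n")
    case True
    have "[n + 1 = 1] (mod 4)"
      using form(2)[OF _ dvd_triv_right] True by simp
    then have "4 dvd n"
      by (simp add: cong_def) presburger
    then obtain c where c: "n = 4 * c" ..
    have "odd c"
    proof
      assume "even c"
      then obtain b where "c = 2 * b" ..
      then have "triangle n = 4 * (b * (n + 1))"
        using twice c by simp
      then have "4 dvd triangle n"
        by simp
      then show False
        using k not_4_dvd_square_plus_1 dvd_trans by blast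
    qed
    then have "pow2_times_primes_1_mod_4 2 n"
      using form(1)[of c 2] c by simp
    moreover have "pow2_times_primes_1_mod_4 0 (n + 1)"
      using form(1)[OF _ dvd_triv_right, of 0] True by simp
    ultimately show ?thesis
      by blast
  next
    case False
    have "[n = 1] (mod 4)"
      by (rule form) (use False in auto)
    then have "n mod 4 = 1"
      by (simp add: cong_def)
    then have "n + 1 = 2 * (2 * (n div 4) + 1)"
      by presburger
    moreover define c where "c = 2 * (n div 4) + 1"
    ultimately have c: "n + 1 = 2 * c" "odd c"
      by simp_all
    have "c dvd n * (n + 1)"
      unfolding c(1) by simp
    then have "pow2_times_primes_1_mod_4 1 (n + 1)"
      using form(1)[of c 1] c by simp
    moreover have "pow2_times_primes_1_mod_4 0 n"
      using form(1)[of n 0] False by simp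
    ultimately show ?thesis
      by blast
  qed
qed

end
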